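(* Let $\bm{u}_h$ be a solution of the semi-discrete discontinuous Galerkin formulation with artificial viscosity: on every element $D^k$, $$\left(\frac{\partial \bm{u}_h}{\partial t}, \bm{w}\right)_{D^k} + \sum_{m=1}^d \left(-\bm{f}_m(\bm{u}_h), \frac{\partial \bm{w}}{\partial x_m}\right)_{D^k} + \left\langle \bm{f}_n^*, \bm{w}\right\rangle_{\partial D^k} = \left(\bm{g}_{\rm visc}, \bm{w}\right)_{D^k} \qquad \forall \bm{w}\in [P^N(D^k)]^n,$$ where $\bm{g}_{\rm visc}$ is the discrete viscous term defined in the context, with viscosity coefficient $\epsilon_k(\bm{u}_h)\ge 0$ on $D^k$. Let $\tilde{\bm{u}} = \bm{u}(\Pi_N \bm{v}(\bm{u}_h))$ denote the entropy projection, and define the volume entropy residual $$\delta_k(\bm{u}_h) = \sum_{m=1}^d \left[ \left(-\bm{f}_m(\bm{u}_h), \frac{\partial \Pi_N\bm{v}(\bm{u}_h)}{\partial x_m}\right)_{D^k} + \left\langle \psi_m(\tilde{\bm{u}})n_m, 1\right\rangle_{\partial D^k}\right].$$ Suppose that on every element $D^k$ the coefficient $\epsilon_k(\bm{u}_h)$ satisfies $$\sum_{i,j=1}^d \left(\epsilon_k(\bm{u}_h)\bm{K}_{ij}\bm{\Theta}_j, \bm{\Theta}_i\right)_{D^k} \geq -\min(0, \delta_k(\bm{u}_h)).$$ Then the following global entropy inequality holds: $$\sum_k \left[\left(\frac{\partial S(\bm{u}_h)}{\partial t}, 1\right)_{D^k} + \left\langle (\Pi_N\bm{v}(\bm{u}_h))^T\bm{f}_n^*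 - \sum_{m=1}^d\psi_m(\tilde{\bm{u}}) n_m, 1\right\rangle_{\partial D^k}\right] \leq 0.$$
   Context: Conservation law: $\frac{\partial \bm{u}}{\partial t}+\sum_{m=1}^d \frac{\partial \bm{f}_m(\bm{u})}{\partial x_m}=0$ with $\bm{u}(\bm{x},t)\in\mathbb{R}^n$ and fluxes $\bm{f}_m:\mathbb{R}^n\to\mathbb{R}^n$. $S(\bm{u})$ is a scalar convex entropy with entropy variables $\bm{v}(\bm{u})=\partial S/\partial\bm{u}$; the map $\bm{u}\mapsto\bm{v}(\bm{u})$ is invertible, with inverse denoted $\bm{v}\mapsto\bm{u}(\bm{v})$. The entropy fluxes are $F_m(\bm{u})=\bm{v}(\bm{u})^T\bm{f}_m(\bm{u})-\psi_m(\bm{u})$, where $\psi_m$ are the scalar entropy potentials. Mesh and discrete inner products: the domain $\Omega\subset\mathbb{R}^d$ is triangulated by non-overlapping simplicial elements $D^k$, each an affine image of a reference simplex; $\bm{n}=(n_1,\dots,n_d)$ is the outward unit normal on $\partial D^k$. $P^N(D^k)$ is the space of polynomials of total degree at most $N$. $(u,v)_{D^k}\approx\int_{D^k}uv$ and $\langle u,v\rangle_{\partial D^k}\approx\int_{\partial D^k}uv$ denote $L^2$ inner products evaluated with volume and surface quadrature rules (possibly inexact); for vector-valued arguments the integrand is the Euclidean dot product. $\Pi_N$ is the (componentwise) $L^2$ projection onto $P^N(D^k)$ with respect to the same discrete inner product: $(\Pi_N f,v)_{D^k}=(f,v)_{D^k}$ for all $v\in P^N(D^k)$. The approximate solution satisfies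 $\bm{u}_h|_{D^k}\in[P^N(D^k)]^n$ and $\frac{\partial \bm{u}_h}{\partial t}|_{D^k}\in[P^N(D^k)]^n$ (method of lines). $\bm{f}_n^*$ is a numerical flux across element interfaces. Viscous term: set $\bm{v}_h=\Pi_N\bm{v}(\bm{u}_h)$. On a face of $D^k$ let $u^-$ be the interior value and $u^+$ the exterior (neighboring) value across the same face, $[\![u]\!]=u^+-u^-$ and $\{\!\{u\}\!\}=\frac12(u^++u^-)$. The blocks $\bm{K}_{ij}\in\mathbb{R}^{n\times n}$, $1\le i,j\le d$ (which may depend on the solution and may be discontinuous between elements), form a symmetric positive semi-definite block matrix $\bm{K}=(\bm{K}_{ij})$. The functions $\bm{\Theta}_i,\bm{\sigma}_i,\bm{g}_{\rm visc}\in[P^N(D^k)]^n$ are defined, for $i=1,\dots,d$, by $$(\bm{\Theta}_i,\bm{w})_{D^k}=\left(\frac{\partial\bm{v}_h}{\partial x_i},\bm{w}\right)_{D^k}+\frac12\langle[\![\bm{v}_h]\!]n_i,\bm{w}\rangle_{\partial D^k},$$ $$(\bm{\sigma}_i,\bm{w})_{D^k}=\Big(\sum_{j=1}^d\epsilon_k(\bm{u}_h)\bm{K}_{ij}\bm{\Theta}_j,\bm{w}\Big)_{D^k},$$ $$(\bm{g}_{\rm visc},\bm{w})_{D^k}=\sum_{i=1}^d\left[\left(-\bm{\sigma}_i,\frac{\partial\bm{w}}{\partial x_i}\right)_{D^k}+\langle\{\!\{\bm{\sigma}_i\}\!\}n_i,\bm{w}\rangle_{\partial D^k}\right],$$ each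 for all $\bm{w}\in[P^N(D^k)]^n$.
   Formalization: The mesh is taken to be periodic, so that every face has a neighboring element (the exterior value is undefined on boundary faces), and the two elements sharing a face use the same surface quadrature nodes and weights on it. *)

theory Defs
  imports "HOL-Analysis.Analysis"
begin

section \<open>Quadrature and polynomials\<close>

text \<open>A quadrature rule is a finite set of nodes together with its weights. No exactness is
  required of it.\<close>

type_synonym 'a quadrature = "'a set \<times> ('a \<Rightarrow> real)"

definition quad :: "'a quadrature \<Rightarrow> ('a \<Rightarrow> real) \<Rightarrow> real" where
  "quad Q g = (\<Sum>x\<in>fst Q. snd Q x * g x)"

definition vol_ip :: "'a quadrature \<Rightarrow> ('a \<Rightarrow> 'b::real_inner) \<Rightarrow> ('a \<Rightarrow> 'b) \<Rightarrow> real" where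
  "vol_ip Q u w = quad Q (\<lambda>x. u x \<bullet> w x)"

text \<open>An element of \<open>P\<^sup>N(D\<^sup>k)\<close> is represented by the polynomial function on the whole space that
  extends it; the extension is unique because the elements have nonempty interior.\<close>

definition poly_space :: "nat \<Rightarrow> (real^'d \<Rightarrow> real) set" where
  "poly_space N = {p. \<exists>c :: ('d \<Rightarrow> nat) \<Rightarrow> real.
     p = (\<lambda>x. \<Sum>\<alpha> | (\<Sum>i\<in>UNIV. \<alpha> i) \<le> N. c \<alpha> * (\<Prod>i\<in>UNIV. (x $ i) ^ \<alpha> i))}"

definition vpoly_space :: "nat \<Rightarrow> (real^'d \<Rightarrow> real^'n) set" where
  "vpoly_space N = {w. \<forall>c. (\<lambda>x. w x $ c) \<in> poly_space N}"

definition pderiv_coord :: "'d \<Rightarrow> (real^'d \<Rightarrow> 'b::real_normed_vector) \<Rightarrow> real^'d \<Rightarrow> 'b" where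
  "pderiv_coord m w x = frechet_derivative w (at x) (axis m 1)"

text \<open>The description in \<open>L2_proj\<close> is proper as soon as the discrete inner product of \<open>Q\<close> is
  positive definite on \<open>poly_space N\<close>.\<close>

definition L2_proj :: "nat \<Rightarrow> (real^'d) quadrature \<Rightarrow> (real^'d \<Rightarrow> real) \<Rightarrow> real^'d \<Rightarrow> real" where
  "L2_proj N Q g = (THE p. p \<in> poly_space N \<and> (\<forall>w\<in>poly_space N. vol_ip Q p w = vol_ip Q g w))"

definition L2_projv ::
  "nat \<Rightarrow> (real^'d) quadrature \<Rightarrow> (real^'d \<Rightarrow> real^'n) \<Rightarrow> real^'d \<Rightarrow> real^'n" where
  "L2_projv N Q g x = (\<chi> c. L2_proj N Q (\<lambda>y. g y $ c) x)"


section \<open>Periodic simplicial meshes\<close>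

text \<open>Element \<open>k\<close> is the simplex with vertex set \<open>verts M k\<close>, and its facets are indexed by the
  opposite vertex: facet \<open>a\<close> is spanned by \<open>verts M k - {a}\<close>. The set \<open>periods M\<close> is the group of
  translations under which the domain is periodic, so that every facet has a neighbouring element on
  its other side, possibly a translated one.\<close>

record ('k, 'd::finite) dg_mesh =
  verts :: "'k \<Rightarrow> (real^'d) set"
  periods :: "(real^'d) set"
  vol_rule :: "'k \<Rightarrow> (real^'d) quadrature"
  surf_rule :: "'k \<Rightarrow> real^'d \<Rightarrow> (real^'d) quadrature"

definition elem :: "('k, 'd::finite) dg_mesh \<Rightarrow> 'k \<Rightarrow> (real^'d) set" where
  "elem M k = convex hull (verts M k)"

definition facet :: "('k, 'd::finite) dg_mesh \<Rightarrow> 'k \<Rightarrow> real^'d \<Rightarrow> (real^'d) set" where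
  "facet M k a = convex hull (verts M k - {a})"

text \<open>Facet \<open>a\<close> of element \<open>k\<close> coincides with the translate by \<open>l\<close> of facet \<open>a'\<close> of element \<open>k'\<close>.\<close>

definition adjacent ::
  "('k, 'd::finite) dg_mesh \<Rightarrow> 'k \<Rightarrow> real^'d \<Rightarrow> 'k \<times> (real^'d) \<times> (real^'d) \<Rightarrow> bool" where
  "adjacent M k a = (\<lambda>(k', a', l). a' \<in> verts M k' \<and> l \<in> periods M \<and> (k', l) \<noteq> (k, 0) \<and>
     verts M k - {a} = (+) l ` (verts M k' - {a'}))"

definition periodic_triangulation :: "('k, 'd::finite) dg_mesh \<Rightarrow> (real^'d) set \<Rightarrow> bool" where
  "periodic_triangulation M \<Omega> \<longleftrightarrow>
     0 \<in> periods M \<and> (\<forall>l\<in>periods M. \<forall>l'\<in>periods M. l - l' \<in> periods M) \<and>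
     (\<forall>k. card (verts M k) = CARD('d) + 1 \<and> \<not> affine_dependent (verts M k)) \<and>
     \<Omega> = (\<Union>k. elem M k) \<and>
     (\<forall>k k'. \<forall>l\<in>periods M. (k', l) \<noteq> (k, 0) \<longrightarrow>
        interior (elem M k) \<inter> interior ((+) l ` elem M k') = {}) \<and>
     (\<forall>k. \<forall>a\<in>verts M k. \<exists>z. adjacent M k a z)"

text \<open>The volume rule defines an inner product on polynomials of degree at most \<open>N\<close>, and the two
  elements meeting at a facet use the same nodes and weights on it.\<close>

definition admissible_quadrature :: "nat \<Rightarrow> ('k, 'd::finite) dg_mesh \<Rightarrow> bool" where
  "admissible_quadrature N M \<longleftrightarrow>
     (\<forall>k. finite (fst (vol_rule M k)) \<and> fst (vol_rule M k) \<subseteq> elem M k \<and>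
        (\<forall>p\<in>poly_space N. p \<noteq> (\<lambda>x. 0) \<longrightarrow> 0 < vol_ip (vol_rule M k) p p)) \<and>
     (\<forall>k. \<forall>a\<in>verts M k. finite (fst (surf_rule M k a)) \<and> fst (surf_rule M k a) \<subseteq> facet M k a) \<and>
     (\<forall>k. \<forall>a\<in>verts M k. \<forall>k' a' l. adjacent M k a (k', a', l) \<longrightarrow>
        fst (surf_rule M k a) = (+) l ` fst (surf_rule M k' a') \<and>
        (\<forall>x\<in>fst (surf_rule M k' a'). snd (surf_rule M k a) (l + x) = snd (surf_rule M k' a') x))"

definition normal :: "('k, 'd::finite) dg_mesh \<Rightarrow> 'k \<Rightarrow> real^'d \<Rightarrow> real^'d" where
  "normal M k a = (THE \<nu>. norm \<nu> = 1 \<and>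
     (\<forall>x\<in>facet M k a. \<forall>y\<in>facet M k a. \<nu> \<bullet> (x - y) = 0) \<and>
     (\<forall>x\<in>facet M k a. \<nu> \<bullet> (a - x) < 0))"

text \<open>Functions on the boundary of an element take the facet as an additional argument, because
  normals, exterior values and numerical fluxes are not single-valued where facets meet.\<close>

definition surf_ip :: "('k, 'd::finite) dg_mesh \<Rightarrow> 'k \<Rightarrow>
    (real^'d \<Rightarrow> real^'d \<Rightarrow> 'b::real_inner) \<Rightarrow> (real^'d \<Rightarrow> real^'d \<Rightarrow> 'b) \<Rightarrow> real" where
  "surf_ip M k u w = (\<Sum>a\<in>verts M k. quad (surf_rule M k a) (\<lambda>x. u a x \<bullet> w a x))"

definition exterior_value ::
  "('k, 'd::finite) dg_mesh \<Rightarrow> ('k \<Rightarrow> real^'d \<Rightarrow> 'b) \<Rightarrow> 'k \<Rightarrow> real^'d \<Rightarrow> real^'d \<Rightarrow> 'b" where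
  "exterior_value M u k a x = (case (THE z. adjacent M k a z) of (k', a', l) \<Rightarrow> u k' (x - l))"

definition jump ::
  "('k, 'd::finite) dg_mesh \<Rightarrow> ('k \<Rightarrow> real^'d \<Rightarrow> 'b::real_vector) \<Rightarrow> 'k \<Rightarrow> real^'d \<Rightarrow> real^'d \<Rightarrow> 'b"
  where "jump M u k a x = exterior_value M u k a x - u k x"

definition average ::
  "('k, 'd::finite) dg_mesh \<Rightarrow> ('k \<Rightarrow> real^'d \<Rightarrow> 'b::real_vector) \<Rightarrow> 'k \<Rightarrow> real^'d \<Rightarrow> real^'d \<Rightarrow> 'b"
  where "average M u k a x = (1/2) *\<^sub>R (exterior_value M u k a x + u k x)"


section \<open>Entropy\<close>

definition convex_entropy :: "(real^'n \<Rightarrow> real) \<Rightarrow> (real^'n \<Rightarrow> real^'n) \<Rightarrow> bool" where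
  "convex_entropy S v \<longleftrightarrow> convex_on UNIV S \<and> (\<forall>u. GDERIV S u :> v u) \<and> bij v"

text \<open>The functions \<open>\<psi> m\<close> are entropy potentials if \<open>F\<^sub>m = v\<^sup>T f\<^sub>m - \<psi>\<^sub>m\<close> are entropy fluxes, that is,
  \<open>F\<^sub>m' = v\<^sup>T f\<^sub>m'\<close>.\<close>

definition entropy_potentials ::
  "('d \<Rightarrow> real^'n \<Rightarrow> real^'n) \<Rightarrow> (real^'n \<Rightarrow> real^'n) \<Rightarrow> ('d \<Rightarrow> real^'n \<Rightarrow> real) \<Rightarrow> bool" where
  "entropy_potentials f v \<psi> \<longleftrightarrow> (\<forall>m u. f m differentiable (at u) \<and>
     ((\<lambda>w. v w \<bullet> f m w - \<psi> m w) has_derivative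
        (\<lambda>h. v u \<bullet> frechet_derivative (f m) (at u) h)) (at u))"

definition proj_entropy_vars :: "nat \<Rightarrow> ('k, 'd::finite) dg_mesh \<Rightarrow> (real^'n \<Rightarrow> real^'n) \<Rightarrow>
    ('k \<Rightarrow> real^'d \<Rightarrow> real^'n) \<Rightarrow> 'k \<Rightarrow> real^'d \<Rightarrow> real^'n" where
  "proj_entropy_vars N M v u k = L2_projv N (vol_rule M k) (\<lambda>x. v (u k x))"

definition entropy_projection :: "nat \<Rightarrow> ('k, 'd::finite) dg_mesh \<Rightarrow> (real^'n \<Rightarrow> real^'n) \<Rightarrow>
    ('k \<Rightarrow> real^'d \<Rightarrow> real^'n) \<Rightarrow> 'k \<Rightarrow> real^'d \<Rightarrow> real^'n" where
  "entropy_projection N M v u k x = inv v (proj_entropy_vars N M v u k x)"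

definition entropy_residual :: "nat \<Rightarrow> ('k, 'd::finite) dg_mesh \<Rightarrow> ('d \<Rightarrow> real^'n \<Rightarrow> real^'n) \<Rightarrow>
    (real^'n \<Rightarrow> real^'n) \<Rightarrow> ('d \<Rightarrow> real^'n \<Rightarrow> real) \<Rightarrow> ('k \<Rightarrow> real^'d \<Rightarrow> real^'n) \<Rightarrow> 'k \<Rightarrow> real" where
  "entropy_residual N M f v \<psi> u k = (\<Sum>m\<in>UNIV.
     vol_ip (vol_rule M k) (\<lambda>x. - f m (u k x)) (pderiv_coord m (proj_entropy_vars N M v u k)) +
     surf_ip M k (\<lambda>a x. \<psi> m (entropy_projection N M v u k x) * normal M k a $ m) (\<lambda>a x. 1))"


section \<open>The semi-discrete scheme\<close>

definition sym_psd_blocks :: "('d::finite \<Rightarrow> 'd \<Rightarrow> real^'n^'n) \<Rightarrow> bool" where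
  "sym_psd_blocks K \<longleftrightarrow> (\<forall>i j. K i j = transpose (K j i)) \<and>
     (\<forall>\<xi>. 0 \<le> (\<Sum>i\<in>UNIV. \<Sum>j\<in>UNIV. \<xi> i \<bullet> (K i j *v \<xi> j)))"

text \<open>Here \<open>e k\<close> is the viscosity coefficient on element \<open>k\<close>, \<open>K k x\<close> the block matrix at the point
  \<open>x\<close> of element \<open>k\<close>, and \<open>vh\<close> the projected entropy variables.\<close>

definition viscous_term :: "nat \<Rightarrow> ('k, 'd::finite) dg_mesh \<Rightarrow> ('k \<Rightarrow> real) \<Rightarrow>
    ('k \<Rightarrow> real^'d \<Rightarrow> 'd \<Rightarrow> 'd \<Rightarrow> real^'n^'n) \<Rightarrow> ('k \<Rightarrow> real^'d \<Rightarrow> real^'n) \<Rightarrow>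
    ('d \<Rightarrow> 'k \<Rightarrow> real^'d \<Rightarrow> real^'n) \<Rightarrow> ('d \<Rightarrow> 'k \<Rightarrow> real^'d \<Rightarrow> real^'n) \<Rightarrow>
    ('k \<Rightarrow> real^'d \<Rightarrow> real^'n) \<Rightarrow> bool" where
  "viscous_term N M e K vh \<Theta> \<sigma> g \<longleftrightarrow>
     (\<forall>k. g k \<in> vpoly_space N \<and> (\<forall>i. \<Theta> i k \<in> vpoly_space N \<and> \<sigma> i k \<in> vpoly_space N)) \<and>
     (\<forall>k. \<forall>w\<in>vpoly_space N.
        (\<forall>i. vol_ip (vol_rule M k) (\<Theta> i k) w =
           vol_ip (vol_rule M k) (pderiv_coord i (vh k)) w +
           1/2 * surf_ip M k (\<lambda>a x. (normal M k a $ i) *\<^sub>R jump M vh k a x) (\<lambda>a. w)) \<and>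
        (\<forall>i. vol_ip (vol_rule M k) (\<sigma> i k) w =
           vol_ip (vol_rule M k) (\<lambda>x. \<Sum>j\<in>UNIV. e k *\<^sub>R (K k x i j *v \<Theta> j k x)) w) \<and>
        vol_ip (vol_rule M k) (g k) w =
          (\<Sum>i\<in>UNIV. vol_ip (vol_rule M k) (\<lambda>x. - \<sigma> i k x) (pderiv_coord i w) +
             surf_ip M k (\<lambda>a x. (normal M k a $ i) *\<^sub>R average M (\<sigma> i) k a x) (\<lambda>a. w)))"

definition time_deriv ::
  "real set \<Rightarrow> (real \<Rightarrow> 'k \<Rightarrow> 'x \<Rightarrow> 'b::real_normed_vector) \<Rightarrow> real \<Rightarrow> 'k \<Rightarrow> 'x \<Rightarrow> 'b" where
  "time_deriv I u t k x = vector_derivative (\<lambda>\<tau>. u \<tau> k x) (at t within I)"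

text \<open>The numerical flux \<open>fstar u k a x\<close> at the point \<open>x\<close> of facet \<open>a\<close> of element \<open>k\<close> may depend on
  the discrete state \<open>u\<close> in any way.\<close>

definition semidiscrete_solution :: "nat \<Rightarrow> ('k, 'd::finite) dg_mesh \<Rightarrow> real set \<Rightarrow>
    ('d \<Rightarrow> real^'n \<Rightarrow> real^'n) \<Rightarrow>
    (('k \<Rightarrow> real^'d \<Rightarrow> real^'n) \<Rightarrow> 'k \<Rightarrow> real^'d \<Rightarrow> real^'d \<Rightarrow> real^'n) \<Rightarrow>
    (real \<Rightarrow> 'k \<Rightarrow> real^'d \<Rightarrow> real^'n) \<Rightarrow> (real \<Rightarrow> 'k \<Rightarrow> real^'d \<Rightarrow> real^'n) \<Rightarrow> bool" where
  "semidiscrete_solution N M I f fstar g uh \<longleftrightarrow>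
     (\<forall>t\<in>I. \<forall>k. uh t k \<in> vpoly_space N \<and> time_deriv I uh t k \<in> vpoly_space N \<and>
        (\<forall>x. (\<lambda>\<tau>. uh \<tau> k x) differentiable (at t within I)) \<and>
        (\<forall>w\<in>vpoly_space N.
           vol_ip (vol_rule M k) (time_deriv I uh t k) w +
           (\<Sum>m\<in>UNIV. vol_ip (vol_rule M k) (\<lambda>x. - f m (uh t k x)) (pderiv_coord m w)) +
           surf_ip M k (fstar (uh t) k) (\<lambda>a. w) =
           vol_ip (vol_rule M k) (g t k) w))"

end

theory Submission
  imports Defs
begin

text \<open>Test the scheme with the projected entropy variables: the time derivative is a polynomial, so
  the projection may be dropped there and the chain rule gives the entropy rate; what remains is the
  viscous term minus the residual. The defining relations of the auxiliary variables turn the viscous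
  term into minus the viscous dissipation plus facet terms, which cancel when summed over all
  elements, since the outward normals of two elements meeting at a facet are opposite. That
  neighbours are unique and lie on opposite sides of a facet follows from the disjointness of the
  element interiors: two simplices on the same side of a common facet overlap.\<close>

subsection \<open>The discrete projection\<close>

lemma vol_ip_add_left: "vol_ip Q (\<lambda>x. u x + u' x) w = vol_ip Q u w + vol_ip Q u' w"
  by (simp add: vol_ip_def quad_def inner_add_left distrib_left sum.distrib)

lemma vol_ip_diff_left: "vol_ip Q (\<lambda>x. u x - u' x) w = vol_ip Q u w - vol_ip Q u' w"
  by (simp add: vol_ip_def quad_def inner_diff_left right_diff_distrib sum_subtractf)

lemma vol_ip_minus_left: "vol_ip Q (\<lambda>x. - u x) w = - vol_ip Q u w"
  by (simp add: vol_ip_def quad_def sum_negf)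

lemma vol_ip_scale_left:
  fixes u w :: "'a \<Rightarrow> real"
  shows "vol_ip Q (\<lambda>x. c * u x) w = c * vol_ip Q u w"
  by (simp add: vol_ip_def quad_def sum_distrib_left algebra_simps)

lemma vol_ip_commute: "vol_ip Q u w = vol_ip Q w u"
  by (simp add: vol_ip_def quad_def inner_commute)

lemma vol_ip_sum_left: "vol_ip Q (\<lambda>x. \<Sum>j\<in>A. u j x) w = (\<Sum>j\<in>A. vol_ip Q (u j) w)"
  unfolding vol_ip_def quad_def inner_sum_left sum_distrib_left by (rule sum.swap)

lemma vol_ip_zero_right: "vol_ip Q u (\<lambda>x. 0) = 0"
  by (simp add: vol_ip_def quad_def)

lemma vol_ip_sum_right: "vol_ip Q u (\<lambda>x. \<Sum>j\<in>A. w j x) = (\<Sum>j\<in>A. vol_ip Q u (w j))"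
  by (simp only: vol_ip_commute[of Q u] vol_ip_sum_left)

lemma vol_ip_scale_right:
  fixes u w :: "'a \<Rightarrow> real"
  shows "vol_ip Q u (\<lambda>x. c * w x) = c * vol_ip Q u w"
  by (simp only: vol_ip_commute[of Q u] vol_ip_scale_left)

lemma vol_ip_vec_nth:
  fixes u w :: "'a \<Rightarrow> real^'n"
  shows "vol_ip Q u w = (\<Sum>c\<in>UNIV. vol_ip Q (\<lambda>x. u x $ c) (\<lambda>x. w x $ c))"
  unfolding vol_ip_def quad_def inner_vec_def sum_distrib_left by (rule sum.swap)

text \<open>Gram-Schmidt by induction on the spanning family. The functions
  \<open>m \<alpha>\<close> may be linearly dependent, so definiteness is asked only of combinations
  that are nonzero as functions.\<close>

lemma projection_exists:
  fixes m :: "'i \<Rightarrow> 'a \<Rightarrow> real"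
  assumes "finite A"
    and "\<And>c. (\<lambda>x. \<Sum>\<alpha>\<in>A. c \<alpha> * m \<alpha> x) \<noteq> (\<lambda>x. 0) \<Longrightarrow>
      0 < vol_ip Q (\<lambda>x. \<Sum>\<alpha>\<in>A. c \<alpha> * m \<alpha> x) (\<lambda>x. \<Sum>\<alpha>\<in>A. c \<alpha> * m \<alpha> x)"
  shows "\<exists>c. \<forall>\<beta>\<in>A. vol_ip Q (\<lambda>x. \<Sum>\<alpha>\<in>A. c \<alpha> * m \<alpha> x) (m \<beta>) = vol_ip Q g (m \<beta>)"
  using assms
proof (induction A arbitrary: g)
  case empty
  then show ?case by simp
next
  case (insert b A)
  let ?s = "\<lambda>c x. \<Sum>\<alpha>\<in>A. c \<alpha> * m \<alpha> x"
  have sum_upd: "(\<lambda>x. \<Sum>\<alpha>\<in>insert b A. (c(b := k)) \<alpha> * m \<alpha> x) = (\<lambda>x. k * m b x + ?s c x)" for c k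
    using insert.hyps by (auto simp: fun_eq_iff intro!: sum.cong)
  have pd: "0 < vol_ip Q (?s c) (?s c)" if "?s c \<noteq> (\<lambda>x. 0)" for c
    using insert.prems[of "c(b := 0)"] that unfolding sum_upd by simp
  have IH: "\<exists>c. \<forall>\<beta>\<in>A. vol_ip Q (?s c) (m \<beta>) = vol_ip Q h (m \<beta>)" for h
    using insert.IH pd by blast
  obtain c where c: "\<And>\<beta>. \<beta> \<in> A \<Longrightarrow> vol_ip Q (?s c) (m \<beta>) = vol_ip Q g (m \<beta>)"
    using IH by blast
  obtain e where e: "\<And>\<beta>. \<beta> \<in> A \<Longrightarrow> vol_ip Q (?s e) (m \<beta>) = vol_ip Q (m b) (m \<beta>)"
    using IH by blast
  \<comment> \<open>The new function minus its projection onto the old span, hence orthogonal to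
    that span.\<close>
  define r where "r = (\<lambda>x. m b x - ?s e x)"
  have r_span: "r = (\<lambda>x. 1 * m b x + ?s (\<lambda>\<alpha>. - e \<alpha>) x)"
    by (simp add: r_def sum_negf)
  have r_orth: "vol_ip Q r (m \<beta>) = 0" if "\<beta> \<in> A" for \<beta>
    using e[OF that] by (simp add: r_def vol_ip_diff_left)
  have r_orth_s: "vol_ip Q r (?s a) = 0" for a
    by (simp add: vol_ip_sum_right vol_ip_scale_right r_orth)
  have mb: "m b = (\<lambda>x. r x + ?s e x)"
    by (simp add: r_def)
  have mb_right: "vol_ip Q h (m b) = vol_ip Q h r + vol_ip Q h (?s e)" for h
    by (subst mb) (simp only: vol_ip_commute[of Q h] vol_ip_add_left)
  have s_right: "vol_ip Q (?s c) (?s e) = vol_ip Q g (?s e)"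
    by (simp add: vol_ip_sum_right[of Q _ "\<lambda>\<alpha> x. e \<alpha> * m \<alpha> x"] vol_ip_scale_right c)
  \<comment> \<open>The component of \<open>g\<close> along \<open>r\<close>; the new projection is
    \<open>k * r\<close> plus the old one. If \<open>m b\<close> already lies in the old span,
    \<open>r\<close> may vanish, and then both sides of \<open>kr\<close> are 0.\<close>
  define k where "k = vol_ip Q g r / vol_ip Q r r"
  have kr: "k * vol_ip Q r r = vol_ip Q g r"
  proof (cases "r = (\<lambda>x. 0)")
    case True
    then show ?thesis by (simp add: vol_ip_zero_right)
  next
    case False
    have "0 < vol_ip Q r r"
      using insert.prems[of "(\<lambda>\<alpha>. - e \<alpha>)(b := 1)"] False unfolding sum_upd r_span by blast
    then show ?thesis by (simp add: k_def)
  qed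
  let ?c = "(\<lambda>\<alpha>. c \<alpha> - k * e \<alpha>)(b := k)"
  have eq: "(\<lambda>x. \<Sum>\<alpha>\<in>insert b A. ?c \<alpha> * m \<alpha> x) = (\<lambda>x. k * r x + ?s c x)"
    unfolding sum_upd r_def
    by (simp add: algebra_simps sum_subtractf sum_distrib_left)
  show ?case
  proof (intro exI[of _ ?c] ballI)
    fix \<beta> assume "\<beta> \<in> insert b A"
    then consider "\<beta> = b" | "\<beta> \<in> A" by blast
    then show "vol_ip Q (\<lambda>x. \<Sum>\<alpha>\<in>insert b A. ?c \<alpha> * m \<alpha> x) (m \<beta>) = vol_ip Q g (m \<beta>)"
    proof cases
      case 1
      show ?thesis
        unfolding eq 1 vol_ip_add_left vol_ip_scale_left mb_right r_orth_s s_right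
        using kr r_orth_s[of c] by (simp add: vol_ip_commute[of Q "?s c" r])
    next
      case 2
      then show ?thesis
        unfolding eq vol_ip_add_left vol_ip_scale_left by (simp add: r_orth c)
    qed
  qed
qed

section \<open>Projection onto polynomials\<close>

lemma finite_multi_indices: "finite {\<alpha> :: 'd::finite \<Rightarrow> nat. (\<Sum>i\<in>UNIV. \<alpha> i) \<le> N}"
proof (rule finite_subset)
  show "{\<alpha> :: 'd \<Rightarrow> nat. (\<Sum>i\<in>UNIV. \<alpha> i) \<le> N} \<subseteq> (\<Pi>\<^sub>E i\<in>UNIV. {..N})"
  proof
    fix \<alpha> :: "'d \<Rightarrow> nat" assume "\<alpha> \<in> {\<alpha>. (\<Sum>i\<in>UNIV. \<alpha> i) \<le> N}"
    then have "\<alpha> i \<le> N" for i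
      using member_le_sum[of i UNIV \<alpha>] by simp
    then show "\<alpha> \<in> (\<Pi>\<^sub>E i\<in>UNIV. {..N})" by (simp add: PiE_iff)
  qed
  show "finite (\<Pi>\<^sub>E i\<in>(UNIV :: 'd set). {..N})"
    by (simp add: finite_PiE)
qed

lemma poly_space_diff:
  assumes "p \<in> poly_space N" "q \<in> poly_space N"
  shows "(\<lambda>x. p x - q x) \<in> poly_space N"
proof -
  from assms obtain c c' where
    "p = (\<lambda>x. \<Sum>\<alpha> | (\<Sum>i\<in>UNIV. \<alpha> i) \<le> N. c \<alpha> * (\<Prod>i\<in>UNIV. (x $ i) ^ \<alpha> i))"
    "q = (\<lambda>x. \<Sum>\<alpha> | (\<Sum>i\<in>UNIV. \<alpha> i) \<le> N. c' \<alpha> * (\<Prod>i\<in>UNIV. (x $ i) ^ \<alpha> i))"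
    unfolding poly_space_def by blast
  then show ?thesis
    unfolding poly_space_def
    by (auto intro!: exI[of _ "\<lambda>\<alpha>. c \<alpha> - c' \<alpha>"] simp: sum_subtractf left_diff_distrib)
qed

text \<open>Shows that the definite description denotes. The monomials span a space on which
  \<open>projection_exists\<close> supplies a candidate, and the difference of two candidates is a
  polynomial orthogonal to itself, hence 0.\<close>

lemma L2_proj_characterization:
  assumes pd: "\<forall>p\<in>poly_space N. p \<noteq> (\<lambda>x. 0) \<longrightarrow> 0 < vol_ip Q p p"
  shows "L2_proj N Q g \<in> poly_space N \<and>
    (\<forall>w\<in>poly_space N. vol_ip Q (L2_proj N Q g) w = vol_ip Q g w)"
proof -
  let ?A = "{\<alpha> :: 'a \<Rightarrow> nat. (\<Sum>i\<in>UNIV. \<alpha> i) \<le> N}"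
  define m :: "('a \<Rightarrow> nat) \<Rightarrow> real^'a \<Rightarrow> real" where "m \<alpha> x = (\<Prod>i\<in>UNIV. (x $ i) ^ \<alpha> i)" for \<alpha> x
  let ?s = "\<lambda>c x. \<Sum>\<alpha>\<in>?A. c \<alpha> * m \<alpha> x"
  have poly: "p \<in> poly_space N \<longleftrightarrow> (\<exists>c. p = ?s c)" for p
    by (simp add: poly_space_def m_def)
  obtain c where c: "\<And>\<beta>. \<beta> \<in> ?A \<Longrightarrow> vol_ip Q (?s c) (m \<beta>) = vol_ip Q g (m \<beta>)"
  proof -
    have "0 < vol_ip Q (?s c) (?s c)" if "?s c \<noteq> (\<lambda>x. 0)" for c
    proof -
      have "?s c \<in> poly_space N" unfolding poly by blast
      then show ?thesis using pd that by (metis (lifting))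
    qed
    from projection_exists[OF finite_multi_indices this] show ?thesis using that by blast
  qed
  define p where "p = ?s c"
  have p_mem: "p \<in> poly_space N" unfolding poly p_def by blast
  have p_proj: "vol_ip Q p w = vol_ip Q g w" if w_mem: "w \<in> poly_space N" for w
  proof -
    obtain e where w: "w = ?s e" using w_mem unfolding poly by blast
    show ?thesis
      unfolding w vol_ip_sum_right vol_ip_scale_right p_def by (intro sum.cong refl) (simp only: c)
  qed
  have p_unique: "q = p"
    if q: "q \<in> poly_space N" and q_proj: "\<forall>w\<in>poly_space N. vol_ip Q q w = vol_ip Q g w" for q
  proof -
    define d where "d = (\<lambda>x. q x - p x)"
    have d_mem: "d \<in> poly_space N" unfolding d_def using q p_mem by (rule poly_space_diff)
    have "vol_ip Q d h = vol_ip Q q h - vol_ip Q p h" for h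
      unfolding d_def by (rule vol_ip_diff_left)
    then have "vol_ip Q d d = 0"
      using d_mem q_proj p_proj by simp
    then have "d = (\<lambda>x. 0)" using pd d_mem by (metis less_irrefl)
    then show "q = p" by (simp add: d_def fun_eq_iff)
  qed
  have "\<exists>!p. p \<in> poly_space N \<and> (\<forall>w\<in>poly_space N. vol_ip Q p w = vol_ip Q g w)"
    using p_mem p_proj p_unique by blast
  from theI'[OF this] show ?thesis unfolding L2_proj_def .
qed

lemma L2_projv_in_vpoly_space:
  assumes "\<forall>p\<in>poly_space N. p \<noteq> (\<lambda>x. 0) \<longrightarrow> 0 < vol_ip Q p p"
  shows "L2_projv N Q g \<in> vpoly_space N"
  unfolding vpoly_space_def L2_projv_def mem_Collect_eq vec_lambda_beta
  using L2_proj_characterization[OF assms] by blast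

lemma vol_ip_L2_projv:
  assumes "\<forall>p\<in>poly_space N. p \<noteq> (\<lambda>x. 0) \<longrightarrow> 0 < vol_ip Q p p"
    and "w \<in> vpoly_space N"
  shows "vol_ip Q (L2_projv N Q g) w = vol_ip Q g w"
proof -
  have "vol_ip Q (\<lambda>x. L2_projv N Q g x $ c) (\<lambda>x. w x $ c) = vol_ip Q (\<lambda>x. g x $ c) (\<lambda>x. w x $ c)" for c
    using L2_proj_characterization[OF assms(1), where g = "\<lambda>x. g x $ c"] assms(2)
    unfolding vpoly_space_def L2_projv_def vec_lambda_beta by blast
  then show ?thesis
    unfolding vol_ip_vec_nth[of Q _ w] by (intro sum.cong refl)
qed

subsection \<open>Simplices sharing a facet\<close>

text \<open>Removing one of \<open>DIM('a) + 1\<close> affinely independent points leaves an affine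
  hull of codimension one, and by independence it misses the removed point.\<close>

lemma affine_hull_facet_eq_hyperplane:
  fixes V :: "'a::euclidean_space set"
  assumes card: "card V = DIM('a) + 1" and indep: "\<not> affine_dependent V" and a: "a \<in> V"
  obtains \<nu> c where "\<nu> \<noteq> 0" "affine hull (V - {a}) = {x. \<nu> \<bullet> x = c}" "\<nu> \<bullet> a \<noteq> c"
proof -
  have fin: "finite V" using indep by (rule aff_independent_finite)
  have "\<not> affine_dependent (V - {a})"
    using indep affine_dependent_subset by blast
  then have "aff_dim (V - {a}) = DIM('a) - 1"
    using aff_dim_affine_independent[of "V - {a}"] card a fin by simp
  then obtain \<nu> c where "\<nu> \<noteq> 0" "affine hull (V - {a}) = {x. \<nu> \<bullet> x = c}"
    using aff_dim_eq_hyperplane by blast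
  moreover have "a \<notin> affine hull (V - {a})"
    using indep a by (auto simp: affine_dependent_def)
  ultimately show ?thesis using that by auto
qed

text \<open>Affinely independent points of this number span the whole space. The last conclusion
  says that an affine function vanishing on the facet is determined by its value at the apex, with
  \<open>u a\<close> as the factor. It is quantified over \<open>\<nu>\<close> and \<open>c\<close>
  so that different functionals can be compared through the same \<open>u\<close>.\<close>

lemma barycentric_decomposition:
  fixes V :: "'a::euclidean_space set"
  assumes card: "card V = DIM('a) + 1" and indep: "\<not> affine_dependent V" and a: "a \<in> V"
  obtains u where "sum u (V - {a}) = 1 - u a" "y = u a *\<^sub>R a + (\<Sum>x\<in>V - {a}. u x *\<^sub>R x)"
    "\<And>\<nu> c. (\<And>x. x \<in> V - {a} \<Longrightarrow> \<nu> \<bullet> x = c) \<Longrightarrow> \<nu> \<bullet> y - c = u a * (\<nu> \<bullet> a - c)"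
proof -
  have fin: "finite V" using indep by (rule aff_independent_finite)
  have "aff_dim V = DIM('a)"
    using aff_dim_affine_independent[OF indep] card by simp
  then have "y \<in> affine hull V"
    using aff_dim_eq_full by blast
  then obtain u where u: "sum u V = 1" "(\<Sum>x\<in>V. u x *\<^sub>R x) = y"
    using affine_hull_finite[OF fin] by auto
  have u_F: "sum u (V - {a}) = 1 - u a"
    using u(1) sum.remove[OF fin a, of u] by simp
  have y_eq: "y = u a *\<^sub>R a + (\<Sum>x\<in>V - {a}. u x *\<^sub>R x)"
    using u(2) sum.remove[OF fin a, of "\<lambda>x. u x *\<^sub>R x"] by simp
  have "\<nu> \<bullet> y - c = u a * (\<nu> \<bullet> a - c)" if on_F: "\<And>x. x \<in> V - {a} \<Longrightarrow> \<nu> \<bullet> x = c" for \<nu> c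
  proof -
    have "\<nu> \<bullet> y = u a * (\<nu> \<bullet> a) + (\<Sum>x\<in>V - {a}. u x * (\<nu> \<bullet> x))"
      by (subst y_eq) (simp add: inner_add_right inner_sum_right)
    also have "(\<Sum>x\<in>V - {a}. u x * (\<nu> \<bullet> x)) = (\<Sum>x\<in>V - {a}. u x * c)"
      using on_F by (intro sum.cong) auto
    also have "\<dots> = (1 - u a) * c"
      by (simp add: sum_distrib_right[symmetric] u_F)
    finally show ?thesis by (simp add: algebra_simps)
  qed
  with u_F y_eq show ?thesis by (rule that)
qed

text \<open>With \<open>u a\<close> the barycentric coordinate of \<open>b\<close> at
  \<open>a\<close>, the product equals \<open>u a * (\<nu> \<bullet> a - c)\<^sup>2\<close>, so the
  claim is that \<open>u a\<close> is negative. It is not 0, as \<open>b\<close> lies off the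
  hyperplane, and a positive value would make the two interiors meet.\<close>

lemma apexes_strictly_separated:
  fixes V W :: "'a::euclidean_space set"
  assumes V: "card V = DIM('a) + 1" "\<not> affine_dependent V" "a \<in> V"
    and W: "card W = DIM('a) + 1" "\<not> affine_dependent W" "b \<in> W"
    and facet: "V - {a} = W - {b}"
    and disj: "interior (convex hull V) \<inter> interior (convex hull W) = {}"
    and hyp: "affine hull (V - {a}) = {x. \<nu> \<bullet> x = c}"
  shows "(\<nu> \<bullet> a - c) * (\<nu> \<bullet> b - c) < 0"
proof -
  define F where "F = V - {a}"
  have V_eq: "V = insert a F" and W_eq: "W = insert b F" and nin: "a \<notin> F" "b \<notin> F"
    using V(3) W(3) facet by (auto simp: F_def)
  have fin: "finite F" using V(2) aff_independent_finite by (auto simp: F_def)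
  have card_F: "card F = DIM('a)" using V(1) nin fin by (simp add: V_eq)
  have b_out: "b \<notin> affine hull F"
    using W(2,3) facet by (auto simp: affine_dependent_def F_def)
  have on_F: "\<nu> \<bullet> x = c" if "x \<in> F" for x
    using hyp hull_inc[of x F affine] that by (auto simp: F_def)
  obtain u where u_F: "sum u F = 1 - u a" and b_eq: "b = u a *\<^sub>R a + (\<Sum>x\<in>F. u x *\<^sub>R x)"
    and coord: "\<And>\<nu> c. (\<And>x. x \<in> F \<Longrightarrow> \<nu> \<bullet> x = c) \<Longrightarrow> \<nu> \<bullet> b - c = u a * (\<nu> \<bullet> a - c)"
    using barycentric_decomposition[OF V, of b] unfolding F_def by blast
  have \<nu>_b: "\<nu> \<bullet> b - c = u a * (\<nu> \<bullet> a - c)"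
    using coord on_F by blast
  have "\<nu> \<bullet> a \<noteq> c" "\<nu> \<bullet> b \<noteq> c"
    using V(2,3) b_out hyp by (auto simp: affine_dependent_def F_def)
  have "u a < 0"
  proof (rule ccontr)
    assume "\<not> u a < 0"
    with \<nu>_b \<open>\<nu> \<bullet> b \<noteq> c\<close> have ua: "0 < u a" by (cases "u a = 0") auto
    \<comment> \<open>A point of the segment from the barycentre of the common facet to \<open>b\<close>, close to the facet,
      has positive barycentric coordinates with respect to both simplices.\<close>
    define n where "n = real DIM('a)"
    have n: "0 < n" by (simp add: n_def)
    \<comment> \<open>Bounds how negative the coordinates of \<open>b\<close> at the common vertices
      can be; the inserted 0 makes the bound nonnegative.\<close>
    define B where "B = Max (insert 0 ((\<lambda>x. - u x) ` F))"
    have B: "0 \<le> B" "\<And>x. x \<in> F \<Longrightarrow> - u x \<le> B"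
      using fin by (auto simp: B_def intro!: Max_ge)
    \<comment> \<open>Chosen so that \<open>n * B * s = 1 - 2 * s\<close>, which is below
      \<open>1 - s\<close>: the weight \<open>(1 - s) / n\<close> of each common vertex then
      outweighs a negative contribution of at most \<open>s * B\<close>.\<close>
    define s where "s = 1 / (2 + n * B)"
    have den: "0 < 2 + n * B" using n B(1) by (simp add: add_pos_nonneg)
    have s: "0 < s" "s < 1" using den n B(1) by (auto simp: s_def field_simps add_pos_nonneg)
    have s_B: "s * B < (1 - s) / n"
    proof -
      have "s * (2 + n * B) = 1" using den by (simp add: s_def)
      then have "s * B * n < 1 - s" using s(1) by (simp add: algebra_simps)
      then show ?thesis using n by (simp add: pos_less_divide_eq)
    qed
    have pos: "0 < (1 - s) / n + s * u x" if "x \<in> F" for x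
    proof -
      have "s * (- u x) \<le> s * B" using B(2)[OF that] s(1) by (intro mult_left_mono) auto
      then show ?thesis using s_B by simp
    qed
    define y where "y = (\<Sum>x\<in>F. ((1 - s) / n) *\<^sub>R x) + s *\<^sub>R b"
    \<comment> \<open>\<open>p\<close> and \<open>q\<close> are the barycentric coordinates of
      \<open>y\<close> in \<open>V\<close> and in \<open>W\<close>; for \<open>p\<close>, the apex
      \<open>b\<close> is expanded in the vertices of \<open>V\<close>.\<close>
    define p where "p x = (if x = a then s * u a else (1 - s) / n + s * u x)" for x
    define q where "q x = (if x = b then s else (1 - s) / n)" for x
    have p_F: "(\<Sum>x\<in>F. p x) = (\<Sum>x\<in>F. (1 - s) / n + s * u x)"
      "(\<Sum>x\<in>F. p x *\<^sub>R x) = (\<Sum>x\<in>F. ((1 - s) / n + s * u x) *\<^sub>R x)"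
      using nin by (auto simp: p_def intro!: sum.cong)
    have q_F: "(\<Sum>x\<in>F. q x) = (\<Sum>x\<in>F. (1 - s) / n)"
      "(\<Sum>x\<in>F. q x *\<^sub>R x) = (\<Sum>x\<in>F. ((1 - s) / n) *\<^sub>R x)"
      using nin by (auto simp: q_def simp del: sum_constant intro!: sum.cong)
    have "y \<in> interior (convex hull V)"
    proof -
      have "sum p V = 1"
        using fin nin n by (simp add: V_eq p_F sum.distrib sum_distrib_left[symmetric] u_F card_F
            n_def[symmetric]) (simp add: p_def algebra_simps)
      moreover have "(\<Sum>x\<in>V. p x *\<^sub>R x) = y"
        using fin nin by (simp add: V_eq p_F y_def)
          (subst b_eq, simp add: p_def scaleR_add_left scaleR_add_right sum.distrib scaleR_sum_right)
      moreover have "\<forall>x\<in>V. 0 < p x"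
        using pos ua s nin by (auto simp: V_eq p_def)
      ultimately show ?thesis
        unfolding interior_convex_hull_explicit_minimal[OF V(2)] using V(1) by auto
    qed
    moreover have "y \<in> interior (convex hull W)"
    proof -
      have "sum q W = 1"
        using fin nin n by (simp add: W_eq q_F card_F n_def[symmetric]) (simp add: q_def)
      moreover have "(\<Sum>x\<in>W. q x *\<^sub>R x) = y"
        using fin nin by (simp add: W_eq q_F y_def) (simp add: q_def)
      moreover have "\<forall>x\<in>W. 0 < q x"
        using s n by (auto simp: q_def)
      ultimately show ?thesis
        unfolding interior_convex_hull_explicit_minimal[OF W(2)] using W(1) by auto
    qed
    ultimately show False using disj by blast
  qed
  moreover have "0 < (\<nu> \<bullet> a - c)\<^sup>2" using \<open>\<nu> \<bullet> a \<noteq> c\<close> by simp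
  ultimately have "u a * (\<nu> \<bullet> a - c)\<^sup>2 < 0" by (rule mult_neg_pos)
  then show ?thesis by (simp add: \<nu>_b power2_eq_square algebra_simps)
qed

text \<open>Uniqueness is the point: by barycentric coordinates, any other functional that is
  constant on the facet and smaller at the apex is a positive multiple of \<open>\<nu>\<close>, and
  equal norms force the factor 1.\<close>

lemma normal_eqI:
  fixes M :: "('k, 'd::finite) dg_mesh"
  assumes simplex: "card (verts M k) = CARD('d) + 1" "\<not> affine_dependent (verts M k)" "a \<in> verts M k"
    and \<nu>: "norm \<nu> = 1" "\<And>x. x \<in> verts M k - {a} \<Longrightarrow> \<nu> \<bullet> x = c" "\<nu> \<bullet> a < c"
  shows "normal M k a = \<nu>"
  unfolding normal_def
proof (rule the_equality)
  let ?F = "verts M k - {a}"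
  have "convex hull ?F \<subseteq> {x. \<nu> \<bullet> x = c}"
    using \<nu>(2) by (intro hull_minimal convex_hyperplane) auto
  then show "norm \<nu> = 1 \<and> (\<forall>x\<in>facet M k a. \<forall>y\<in>facet M k a. \<nu> \<bullet> (x - y) = 0) \<and>
      (\<forall>x\<in>facet M k a. \<nu> \<bullet> (a - x) < 0)"
    using \<nu>(1,3) by (auto simp: facet_def inner_diff_right)
next
  let ?F = "verts M k - {a}"
  fix \<mu>
  assume "norm \<mu> = 1 \<and> (\<forall>x\<in>facet M k a. \<forall>y\<in>facet M k a. \<mu> \<bullet> (x - y) = 0) \<and>
      (\<forall>x\<in>facet M k a. \<mu> \<bullet> (a - x) < 0)"
  then have \<mu>: "norm \<mu> = 1" "\<And>x y. x \<in> facet M k a \<Longrightarrow> y \<in> facet M k a \<Longrightarrow> \<mu> \<bullet> (x - y) = 0"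
    "\<And>x. x \<in> facet M k a \<Longrightarrow> \<mu> \<bullet> (a - x) < 0"
    by blast+
  have simplex': "card (verts M k) = DIM(real^'d) + 1" using simplex(1) by simp
  have "finite (verts M k)" using simplex(2) by (rule aff_independent_finite)
  then have "card ?F \<noteq> 0" using simplex(1,3) by simp
  then obtain z where z: "z \<in> ?F" by (metis card.empty ex_in_conv)
  have F_facet: "x \<in> facet M k a" if "x \<in> ?F" for x
    unfolding facet_def using that by (rule hull_inc)
  define e where "e = \<mu> \<bullet> z"
  have \<mu>_F: "\<mu> \<bullet> x = e" if "x \<in> ?F" for x
    using \<mu>(2)[OF F_facet[OF that] F_facet[OF z]] by (simp add: e_def inner_diff_right)
  have \<mu>_a: "\<mu> \<bullet> a < e"
    using \<mu>(3)[OF F_facet[OF z]] by (simp add: e_def inner_diff_right)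
  define r where "r = (\<mu> \<bullet> a - e) / (\<nu> \<bullet> a - c)"
  have r: "0 < r" unfolding r_def using \<mu>_a \<nu>(3) by (simp add: divide_neg_neg)
  have proportional: "\<mu> \<bullet> y - e = r * (\<nu> \<bullet> y - c)" for y
  proof -
    obtain u where u: "\<And>\<nu> c. (\<And>x. x \<in> ?F \<Longrightarrow> \<nu> \<bullet> x = c) \<Longrightarrow> \<nu> \<bullet> y - c = u a * (\<nu> \<bullet> a - c)"
      using barycentric_decomposition[OF simplex' simplex(2,3), of y] by blast
    have "\<mu> \<bullet> y - e = u a * (\<mu> \<bullet> a - e)" "\<nu> \<bullet> y - c = u a * (\<nu> \<bullet> a - c)"
      using u \<mu>_F \<nu>(2) by blast+
    then show ?thesis using \<nu>(3) by (simp add: r_def)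
  qed
  \<comment> \<open>Evaluating at the origin matches the constants, which turns the affine identity
    into one between linear functionals.\<close>
  have "e = r * c" using proportional[of 0] by simp
  then have "(\<mu> - r *\<^sub>R \<nu>) \<bullet> y = 0" for y
    using proportional[of y] by (simp add: inner_diff_left algebra_simps)
  then have "\<mu> - r *\<^sub>R \<nu> = 0" using inner_eq_zero_iff by blast
  then have \<mu>_eq: "\<mu> = r *\<^sub>R \<nu>" by simp
  then have "r = 1" using \<mu>(1) \<nu>(1) r by simp
  then show "\<mu> = \<nu>" using \<mu>_eq by simp
qed

text \<open>The mesh condition keeps one of the two elements untranslated, so it is applied with
  \<open>l2 - l1\<close> and the result is shifted by \<open>l1\<close>. Allowing two translates
  covers both an element against its neighbour and two neighbours against each other.\<close>

lemma neighbour_apexes_strictly_separated: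
  fixes M :: "('k, 'd::finite) dg_mesh"
  assumes mesh: "periodic_triangulation M \<Omega>"
    and k1: "a1 \<in> verts M k1" "l1 \<in> periods M" and k2: "a2 \<in> verts M k2" "l2 \<in> periods M"
    and neq: "(k1, l1) \<noteq> (k2, l2)"
    and facet: "(+) l1 ` (verts M k1 - {a1}) = (+) l2 ` (verts M k2 - {a2})"
    and hyp: "affine hull ((+) l1 ` (verts M k1 - {a1})) = {x. \<nu> \<bullet> x = c}"
  shows "(\<nu> \<bullet> (l1 + a1) - c) * (\<nu> \<bullet> (l2 + a2) - c) < 0"
proof -
  let ?V = "(+) l1 ` verts M k1" and ?W = "(+) l2 ` verts M k2"
  have simplex: "card (verts M k) = CARD('d) + 1" "\<not> affine_dependent (verts M k)" for k
    using mesh by (auto simp: periodic_triangulation_def)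
  have V_diff: "(+) l ` (verts M k - {a}) = (+) l ` verts M k - {l + a}" for l k a
    by (auto simp: image_set_diff)
  have "l2 - l1 \<in> periods M" "(k2, l2 - l1) \<noteq> (k1, 0)"
    using mesh k1(2) k2(2) neq by (auto simp: periodic_triangulation_def)
  then have "interior (elem M k1) \<inter> interior ((+) (l2 - l1) ` elem M k2) = {}"
    using mesh unfolding periodic_triangulation_def by blast
  then have "(+) l1 ` (interior (elem M k1) \<inter> interior ((+) (l2 - l1) ` elem M k2)) = {}"
    by simp
  moreover have "(+) l1 ` (+) (l2 - l1) ` elem M k2 = (+) l2 ` elem M k2"
    by (simp add: image_image)
  ultimately have "interior ((+) l1 ` elem M k1) \<inter> interior ((+) l2 ` elem M k2) = {}"
    by (simp add: image_Int interior_translation[symmetric])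
  then have disj: "interior (convex hull ?V) \<inter> interior (convex hull ?W) = {}"
    by (simp add: elem_def convex_hull_translation)
  show ?thesis
  proof (rule apexes_strictly_separated)
    show "card ?V = DIM(real^'d) + 1" "card ?W = DIM(real^'d) + 1"
      using simplex(1) by (simp_all add: card_image)
    show "\<not> affine_dependent ?V" "\<not> affine_dependent ?W"
      using simplex(2) by (simp_all add: affine_dependent_translation_eq[symmetric])
    show "l1 + a1 \<in> ?V" "l2 + a2 \<in> ?W" using k1(1) k2(1) by auto
    show "?V - {l1 + a1} = ?W - {l2 + a2}" using facet by (simp add: V_diff)
    show "affine hull (?V - {l1 + a1}) = {x. \<nu> \<bullet> x = c}" using hyp by (simp add: V_diff)
  qed (rule disj)
qed

section \<open>Uniqueness of neighbours and opposite normals\<close>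

lemma adjacent_sym:
  assumes "periodic_triangulation M \<Omega>" "a \<in> verts M k" "adjacent M k a (k', a', l)"
  shows "adjacent M k' a' (k, a, - l)"
proof -
  have "0 - l \<in> periods M"
    using assms by (auto simp: periodic_triangulation_def adjacent_def)
  moreover have "verts M k' - {a'} = (+) (- l) ` (verts M k - {a})"
    using assms(3) by (auto simp: adjacent_def image_image)
  ultimately show ?thesis
    using assms(2,3) by (auto simp: adjacent_def)
qed

text \<open>A hyperplane has only two sides, so three distinct simplices on one facet cannot have
  pairwise separated apexes.\<close>

lemma adjacent_unique:
  fixes M :: "('k, 'd::finite) dg_mesh"
  assumes mesh: "periodic_triangulation M \<Omega>" and a: "a \<in> verts M k"
    and adj: "adjacent M k a (k1, a1, l1)" "adjacent M k a (k2, a2, l2)"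
  shows "(k1, a1, l1) = (k2, a2, l2)"
proof -
  have simplex: "card (verts M k) = DIM(real^'d) + 1" "\<not> affine_dependent (verts M k)"
    and zero: "0 \<in> periods M"
    using mesh by (auto simp: periodic_triangulation_def)
  note a1 = adj(1)[unfolded adjacent_def, simplified] and a2 = adj(2)[unfolded adjacent_def, simplified]
  obtain \<nu> c where "affine hull (verts M k - {a}) = {x. \<nu> \<bullet> x = c}"
    using affine_hull_facet_eq_hyperplane[OF simplex a] by blast
  \<comment> \<open>The translation by 0 is written out so that the element itself is an instance of
    the separation lemma.\<close>
  then have hyp: "affine hull ((+) 0 ` (verts M k - {a})) = {x. \<nu> \<bullet> x = c}"
    "affine hull ((+) l1 ` (verts M k1 - {a1})) = {x. \<nu> \<bullet> x = c}"
    using a1 by simp_all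
  have sep: "(\<nu> \<bullet> (0 + a) - c) * (\<nu> \<bullet> (l1 + a1) - c) < 0"
    "(\<nu> \<bullet> (0 + a) - c) * (\<nu> \<bullet> (l2 + a2) - c) < 0"
    using a1 a2
    by (intro neighbour_apexes_strictly_separated[OF mesh a zero _ _ _ _ hyp(1)]; auto)+
  have same: "(k1, l1) = (k2, l2)"
  proof (rule ccontr)
    assume "(k1, l1) \<noteq> (k2, l2)"
    then have "(\<nu> \<bullet> (l1 + a1) - c) * (\<nu> \<bullet> (l2 + a2) - c) < 0"
      using a1 a2 by (intro neighbour_apexes_strictly_separated[OF mesh _ _ _ _ _ _ hyp(2)]) auto
    with sep show False by (auto simp: mult_less_0_iff)
  qed
  then have "(+) l1 ` (verts M k1 - {a1}) = (+) l1 ` (verts M k1 - {a2})"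
    using a1 a2 by simp
  then have "verts M k1 - {a1} = verts M k1 - {a2}"
    by (simp add: inj_image_eq_iff)
  then have "a1 = a2" using same a1 a2 by auto
  with same show ?thesis by simp
qed

lemma the_adjacent:
  assumes "periodic_triangulation M \<Omega>" "a \<in> verts M k" "adjacent M k a z"
  shows "(THE z. adjacent M k a z) = z"
  using assms(3)
proof (rule the_equality)
  show "z' = z" if "adjacent M k a z'" for z'
    using adjacent_unique[OF assms(1,2)] assms(3) that by (cases z, cases z') blast
qed

text \<open>The two facets agree up to translation, hence have the same normal direction, and the
  apexes lie on opposite sides, which reverses the orientation.\<close>

lemma normal_adjacent:
  fixes M :: "('k, 'd::finite) dg_mesh"
  assumes mesh: "periodic_triangulation M \<Omega>" and a: "a \<in> verts M k"
    and adj: "adjacent M k a (k', a', l)"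
  shows "normal M k' a' = - normal M k a"
proof -
  have simplex: "card (verts M k) = CARD('d) + 1" "\<not> affine_dependent (verts M k)" for k
    using mesh by (auto simp: periodic_triangulation_def)
  have zero: "0 \<in> periods M"
    using mesh by (auto simp: periodic_triangulation_def)
  have a': "a' \<in> verts M k'" and l: "l \<in> periods M" "(k', l) \<noteq> (k, 0)"
    and facet: "verts M k - {a} = (+) l ` (verts M k' - {a'})"
    using adj by (auto simp: adjacent_def)
  obtain \<rho> r where \<rho>: "\<rho> \<noteq> 0" "affine hull (verts M k - {a}) = {x. \<rho> \<bullet> x = r}" "\<rho> \<bullet> a \<noteq> r"
    using affine_hull_facet_eq_hyperplane[of "verts M k" a] simplex a by auto
  \<comment> \<open>Scales \<open>\<rho>\<close> to unit length and orients it away from the apex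
    \<open>a\<close>.\<close>
  define s where "s = (if \<rho> \<bullet> a < r then 1 else -1) / norm \<rho>"
  define \<nu> c where "\<nu> = s *\<^sub>R \<rho>" and "c = s * r"
  have s: "s \<noteq> 0" "\<bar>s\<bar> * norm \<rho> = 1" "s * (\<rho> \<bullet> a - r) < 0"
    using \<rho>(1,3) by (auto simp: s_def divide_neg_pos)
  have hyp: "affine hull ((+) 0 ` (verts M k - {a})) = {x. \<nu> \<bullet> x = c}"
    using \<rho>(2) s(1) by (simp add: \<nu>_def c_def)
  have \<nu>: "norm \<nu> = 1" "\<nu> \<bullet> a < c"
    using s(2,3) by (simp_all add: \<nu>_def c_def algebra_simps)
  have \<nu>_F: "\<nu> \<bullet> x = c" if "x \<in> verts M k - {a}" for x
    using hyp hull_inc[OF that, of affine] by auto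
  have "(\<nu> \<bullet> (0 + a) - c) * (\<nu> \<bullet> (l + a') - c) < 0"
    using a' l facet by (intro neighbour_apexes_strictly_separated[OF mesh a zero _ _ _ _ hyp]) auto
  \<comment> \<open>Pulled back by \<open>l\<close>, the hyperplane of the facet becomes the level
    set of \<open>- \<nu>\<close> at height \<open>\<nu> \<bullet> l - c\<close>; the apex
    \<open>a'\<close> lies strictly below that height.\<close>
  with \<nu>(2) have "- \<nu> \<bullet> a' < \<nu> \<bullet> l - c"
    by (auto simp: mult_less_0_iff inner_add_right)
  moreover have "- \<nu> \<bullet> x = \<nu> \<bullet> l - c" if "x \<in> verts M k' - {a'}" for x
    using \<nu>_F[of "l + x"] that facet by (auto simp: inner_add_right)
  ultimately have "normal M k' a' = - \<nu>"
    using simplex a' \<nu>(1) by (intro normal_eqI) auto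
  moreover have "normal M k a = \<nu>"
    using simplex a \<nu> \<nu>_F by (intro normal_eqI) auto
  ultimately show ?thesis by simp
qed

subsection \<open>Facet terms\<close>

lemma surf_ip_sum_left:
  "surf_ip M k (\<lambda>a x. \<Sum>j\<in>A. u j a x) w = (\<Sum>j\<in>A. surf_ip M k (u j) w)"
  unfolding surf_ip_def quad_def inner_sum_left sum_distrib_left
  by (subst (2) sum.swap) (subst (1) sum.swap, rule refl)

lemma exterior_value_adjacent:
  assumes "periodic_triangulation M \<Omega>" "a \<in> verts M k" "adjacent M k a (k', a', l)"
  shows "exterior_value M u k a x = u k' (x - l)"
  unfolding exterior_value_def the_adjacent[OF assms] by simp

lemma quad_surf_rule_adjacent:
  assumes "admissible_quadrature N M" "a \<in> verts M k" "adjacent M k a (k', a', l)"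
  shows "quad (surf_rule M k a) h = quad (surf_rule M k' a') (\<lambda>x. h (l + x))"
proof -
  have nodes: "fst (surf_rule M k a) = (+) l ` fst (surf_rule M k' a')"
    and weights: "\<And>x. x \<in> fst (surf_rule M k' a') \<Longrightarrow>
      snd (surf_rule M k a) (l + x) = snd (surf_rule M k' a') x"
    using assms unfolding admissible_quadrature_def by blast+
  have "quad (surf_rule M k a) h =
      (\<Sum>x\<in>fst (surf_rule M k' a'). snd (surf_rule M k a) (l + x) * h (l + x))"
    unfolding quad_def nodes by (subst sum.reindex) auto
  also have "\<dots> = quad (surf_rule M k' a') (\<lambda>x. h (l + x))"
    unfolding quad_def by (intro sum.cong refl) (simp only: weights)
  finally show ?thesis .
qed

text \<open>Passing to the neighbour is an involution on pairs of element and facet that reverses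
  the sign of the summand, so the sum equals its own negative.\<close>

lemma sum_over_facets_eq_0:
  fixes M :: "('k::finite, 'd::finite) dg_mesh" and G :: "'k \<Rightarrow> real^'d \<Rightarrow> real"
  assumes mesh: "periodic_triangulation M \<Omega>"
    and antisym: "\<And>k a k' a' l. a \<in> verts M k \<Longrightarrow> adjacent M k a (k', a', l) \<Longrightarrow> G k' a' = - G k a"
  shows "(\<Sum>k\<in>UNIV. \<Sum>a\<in>verts M k. G k a) = 0"
proof -
  define E where "E = (SIGMA k:UNIV. verts M k)"
  define g where "g z = G (fst z) (snd z)" for z
  \<comment> \<open>The translation is dropped: \<open>G\<close> depends only on the element and the
    facet.\<close>
  define nb where "nb z = (case THE z'. adjacent M (fst z) (snd z) z' of (k', a', l) \<Rightarrow> (k', a'))" for z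
  have nb: "nb z \<in> E \<and> nb (nb z) = z \<and> g (nb z) = - g z" if "z \<in> E" for z
  proof -
    obtain k a where z: "z = (k, a)" by (cases z)
    then have a: "a \<in> verts M k" using that by (simp add: E_def)
    obtain k' a' l where adj: "adjacent M k a (k', a', l)"
      using mesh a unfolding periodic_triangulation_def by (metis prod_cases3)
    then have a': "a' \<in> verts M k'" by (simp add: adjacent_def)
    have "nb z = (k', a')"
      unfolding nb_def z fst_conv snd_conv the_adjacent[OF mesh a adj] by simp
    moreover have "nb (k', a') = (k, a)"
      unfolding nb_def fst_conv snd_conv the_adjacent[OF mesh a' adjacent_sym[OF mesh a adj]] by simp
    ultimately show ?thesis
      using a' antisym[OF a adj] by (simp add: z E_def g_def)
  qed
  have fin: "finite (verts M k)" for k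
    using mesh by (metis periodic_triangulation_def aff_independent_finite)
  have "sum g E = (\<Sum>z\<in>E. g (nb z))"
    by (rule sum.reindex_bij_witness[of _ nb nb]) (simp_all add: nb)
  also have "\<dots> = - sum g E"
    unfolding sum_negf[symmetric] by (intro sum.cong refl) (simp add: nb)
  finally have "sum g E = 0" by simp
  moreover have "(\<Sum>k\<in>UNIV. \<Sum>a\<in>verts M k. G k a) = sum g E"
    unfolding E_def g_def by (subst sum.Sigma) (auto simp: fin split_beta)
  ultimately show ?thesis by simp
qed

text \<open>On each facet the interior contributions cancel, which leaves the products of the values from
  opposite sides times the normal. These change sign when the two elements are exchanged.\<close>

lemma sum_surface_jump_average:
  fixes M :: "('k::finite, 'd::finite) dg_mesh" and p q :: "'k \<Rightarrow> real^'d \<Rightarrow> 'b::real_inner"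
  assumes mesh: "periodic_triangulation M \<Omega>" and quadrature: "admissible_quadrature N M"
  shows "(\<Sum>k\<in>UNIV. 1/2 * surf_ip M k (\<lambda>a x. (normal M k a $ i) *\<^sub>R jump M p k a x) (\<lambda>a. q k) +
    surf_ip M k (\<lambda>a x. (normal M k a $ i) *\<^sub>R average M q k a x) (\<lambda>a. p k)) = 0"
proof -
  define h where "h k a x = normal M k a $ i / 2 *
    (exterior_value M p k a x \<bullet> q k x + exterior_value M q k a x \<bullet> p k x)" for k a x
  have "quad (surf_rule M k' a') (h k' a') = - quad (surf_rule M k a) (h k a)"
    if a: "a \<in> verts M k" and adj: "adjacent M k a (k', a', l)" for k a k' a' l
  proof -
    have a': "a' \<in> verts M k'" using adj by (simp add: adjacent_def)
    have "h k a (l + x) = - h k' a' x" for x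
      unfolding h_def exterior_value_adjacent[OF mesh a adj]
        exterior_value_adjacent[OF mesh a' adjacent_sym[OF mesh a adj]] normal_adjacent[OF mesh a adj]
      by (simp add: inner_commute algebra_simps)
    then show ?thesis
      unfolding quad_surf_rule_adjacent[OF quadrature a adj] by (simp add: quad_def sum_negf)
  qed
  then have "(\<Sum>k\<in>UNIV. \<Sum>a\<in>verts M k. quad (surf_rule M k a) (h k a)) = 0"
    by (rule sum_over_facets_eq_0[OF mesh])
  moreover have "1/2 * surf_ip M k (\<lambda>a x. (normal M k a $ i) *\<^sub>R jump M p k a x) (\<lambda>a. q k) +
      surf_ip M k (\<lambda>a x. (normal M k a $ i) *\<^sub>R average M q k a x) (\<lambda>a. p k) =
      (\<Sum>a\<in>verts M k. quad (surf_rule M k a) (h k a))" for k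
    unfolding surf_ip_def quad_def sum_distrib_left sum.distrib[symmetric] h_def jump_def average_def
      inner_scaleR_left inner_add_left inner_diff_left inner_commute[of "q k _" "p k _"]
    by (intro sum.cong refl) (simp add: field_simps)
  ultimately show ?thesis by simp
qed

section \<open>The entropy along the time evolution\<close>

lemma at_within_interval_neq_bot:
  fixes I :: "real set"
  assumes "is_interval I" "interior I \<noteq> {}" "t \<in> I"
  shows "at t within I \<noteq> bot"
proof -
  \<comment> \<open>A connected set other than a singleton has no isolated point, so endpoints of
    \<open>I\<close> are covered as well.\<close>
  have "I \<noteq> {x}" for x using assms(2) by auto
  then have "t islimpt I"
    using assms(1,3) connected_imp_perfect is_interval_connected by blast
  then show ?thesis by (simp add: trivial_limit_within)
qed

text \<open>The chain rule relative to \<open>I\<close>. The nontrivial filter makes derivatives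
  within \<open>I\<close> unique, so the value selected by \<open>time_deriv\<close> is the one
  computed.\<close>

lemma time_deriv_gradient_compose:
  fixes u :: "real \<Rightarrow> 'k \<Rightarrow> 'x \<Rightarrow> real^'n"
  assumes "at t within I \<noteq> bot" "(\<lambda>\<tau>. u \<tau> k x) differentiable (at t within I)"
    and "GDERIV S (u t k x) :> v"
  shows "time_deriv I (\<lambda>\<tau> k x. S (u \<tau> k x)) t k x = time_deriv I u t k x \<bullet> v"
proof -
  have "((\<lambda>\<tau>. u \<tau> k x) has_vector_derivative time_deriv I u t k x) (at t within I)"
    using assms(2) by (simp add: time_deriv_def vector_derivative_works)
  then have "((\<lambda>\<tau>. S (u \<tau> k x)) has_derivative (\<lambda>h. (h *\<^sub>R time_deriv I u t k x) \<bullet> v)) (at t within I)"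
    using assms(3) unfolding gderiv_def has_vector_derivative_def
    by (rule has_derivative_compose)
  then have "((\<lambda>\<tau>. S (u \<tau> k x)) has_vector_derivative time_deriv I u t k x \<bullet> v) (at t within I)"
    by (simp add: has_vector_derivative_def)
  then show ?thesis
    unfolding time_deriv_def by (rule vector_derivative_within[OF assms(1)])
qed

subsection \<open>The entropy inequality\<close>

text \<open>By periodicity every facet has a neighbour, so no boundary data enter. The numerical
  flux is arbitrary: it is carried into the conclusion instead of being estimated.\<close>

theorem lemma2:
  fixes M :: "('k::finite, 'd::finite) dg_mesh" and \<Omega> :: "(real^'d) set" and N :: nat
    and f :: "'d \<Rightarrow> real^'n \<Rightarrow> real^'n" and S :: "real^'n \<Rightarrow> real"
    and v :: "real^'n \<Rightarrow> real^'n" and \<psi> :: "'d \<Rightarrow> real^'n \<Rightarrow> real"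
    and fstar :: "('k \<Rightarrow> real^'d \<Rightarrow> real^'n) \<Rightarrow> 'k \<Rightarrow> real^'d \<Rightarrow> real^'d \<Rightarrow> real^'n"
    and \<epsilon> :: "'k \<Rightarrow> ('k \<Rightarrow> real^'d \<Rightarrow> real^'n) \<Rightarrow> real"
    and K :: "('k \<Rightarrow> real^'d \<Rightarrow> real^'n) \<Rightarrow> 'k \<Rightarrow> real^'d \<Rightarrow> 'd \<Rightarrow> 'd \<Rightarrow> real^'n^'n"
    and I :: "real set"
    and uh g :: "real \<Rightarrow> 'k \<Rightarrow> real^'d \<Rightarrow> real^'n"
    and \<Theta> \<sigma> :: "real \<Rightarrow> 'd \<Rightarrow> 'k \<Rightarrow> real^'d \<Rightarrow> real^'n"
  assumes mesh: "periodic_triangulation M \<Omega>" and quadrature: "admissible_quadrature N M"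
    and entropy: "convex_entropy S v" and potentials: "entropy_potentials f v \<psi>"
    and interval: "is_interval I" "interior I \<noteq> {}"
    and K_psd: "\<And>t k x. t \<in> I \<Longrightarrow> x \<in> elem M k \<Longrightarrow> sym_psd_blocks (K (uh t) k x)"
    and eps_nonneg: "\<And>t k. t \<in> I \<Longrightarrow> 0 \<le> \<epsilon> k (uh t)"
    and viscous: "\<And>t. t \<in> I \<Longrightarrow> viscous_term N M (\<lambda>k. \<epsilon> k (uh t)) (K (uh t))
                     (proj_entropy_vars N M v (uh t)) (\<Theta> t) (\<sigma> t) (g t)"
    and solution: "semidiscrete_solution N M I f fstar g uh"
    and t: "t \<in> I"
    and eps_large: "\<And>k. (\<Sum>i\<in>UNIV. \<Sum>j\<in>UNIV. vol_ip (vol_rule M k)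
                       (\<lambda>x. \<epsilon> k (uh t) *\<^sub>R (K (uh t) k x i j *v \<Theta> t j k x)) (\<Theta> t i k))
                     \<ge> - min 0 (entropy_residual N M f v \<psi> (uh t) k)"
  shows "(\<Sum>k\<in>UNIV.
            vol_ip (vol_rule M k) (time_deriv I (\<lambda>\<tau> k x. S (uh \<tau> k x)) t k) (\<lambda>x. 1) +
            surf_ip M k (\<lambda>a x. proj_entropy_vars N M v (uh t) k x \<bullet> fstar (uh t) k a x -
                (\<Sum>m\<in>UNIV. \<psi> m (entropy_projection N M v (uh t) k x) * normal M k a $ m))
              (\<lambda>a x. 1)) \<le> 0"
proof -
  define vh where "vh = proj_entropy_vars N M v (uh t)"
  define Q where "Q = vol_rule M"
  define D where "D k = (\<Sum>i\<in>UNIV. \<Sum>j\<in>UNIV. vol_ip (Q k)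
    (\<lambda>x. \<epsilon> k (uh t) *\<^sub>R (K (uh t) k x i j *v \<Theta> t j k x)) (\<Theta> t i k))" for k
  define \<delta> where "\<delta> k = entropy_residual N M f v \<psi> (uh t) k" for k
  define ent where "ent k = vol_ip (Q k) (time_deriv I (\<lambda>\<tau> k x. S (uh \<tau> k x)) t k) (\<lambda>x. 1) +
    surf_ip M k (\<lambda>a x. vh k x \<bullet> fstar (uh t) k a x -
      (\<Sum>m\<in>UNIV. \<psi> m (entropy_projection N M v (uh t) k x) * normal M k a $ m)) (\<lambda>a x. 1)" for k
  have pd: "\<forall>p\<in>poly_space N. p \<noteq> (\<lambda>x. 0) \<longrightarrow> 0 < vol_ip (Q k) p p" for k
    using quadrature unfolding admissible_quadrature_def Q_def by blast
  have vh_mem: "vh k \<in> vpoly_space N" for k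
    unfolding vh_def proj_entropy_vars_def Q_def[symmetric] by (rule L2_projv_in_vpoly_space[OF pd])
  have vh_proj: "vol_ip (Q k) (vh k) w = vol_ip (Q k) (\<lambda>x. v (uh t k x)) w"
    if "w \<in> vpoly_space N" for k w
    unfolding vh_def proj_entropy_vars_def Q_def[symmetric] by (rule vol_ip_L2_projv[OF pd that])

  have differentiable: "(\<lambda>\<tau>. uh \<tau> k x) differentiable (at t within I)"
    and ut_mem: "time_deriv I uh t k \<in> vpoly_space N"
    and scheme: "vol_ip (Q k) (time_deriv I uh t k) (vh k) +
      (\<Sum>m\<in>UNIV. vol_ip (Q k) (\<lambda>x. - f m (uh t k x)) (pderiv_coord m (vh k))) +
      surf_ip M k (fstar (uh t) k) (\<lambda>a. vh k) = vol_ip (Q k) (g t k) (vh k)" for k x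
    using solution t vh_mem unfolding semidiscrete_solution_def Q_def by blast+
  have gradient: "GDERIV S u :> v u" for u
    using entropy by (simp add: convex_entropy_def)
  have entropy_rate: "vol_ip (Q k) (time_deriv I (\<lambda>\<tau> k x. S (uh \<tau> k x)) t k) (\<lambda>x. 1) =
    vol_ip (Q k) (time_deriv I uh t k) (vh k)" for k
  proof -
    have "time_deriv I (\<lambda>\<tau> k x. S (uh \<tau> k x)) t k x = time_deriv I uh t k x \<bullet> v (uh t k x)" for x
      by (rule time_deriv_gradient_compose[OF at_within_interval_neq_bot[OF interval t]
            differentiable gradient])
    then have "vol_ip (Q k) (time_deriv I (\<lambda>\<tau> k x. S (uh \<tau> k x)) t k) (\<lambda>x. 1) =
        vol_ip (Q k) (time_deriv I uh t k) (\<lambda>x. v (uh t k x))"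
      by (simp add: vol_ip_def)
    then show ?thesis
      using vh_proj[OF ut_mem] by (simp add: vol_ip_commute[of _ "time_deriv I uh t k"])
  qed
  \<comment> \<open>The tested scheme trades the time derivative and the interface flux for the
    viscous term minus the volume flux term; with the potentials on the boundary, the latter makes
    up \<open>\<delta> k\<close>.\<close>
  have balance: "ent k = vol_ip (Q k) (g t k) (vh k) - \<delta> k" for k
  proof -
    have "surf_ip M k (\<lambda>a x. vh k x \<bullet> fstar (uh t) k a x -
        (\<Sum>m\<in>UNIV. \<psi> m (entropy_projection N M v (uh t) k x) * normal M k a $ m)) (\<lambda>a x. 1) =
      surf_ip M k (fstar (uh t) k) (\<lambda>a. vh k) -
      surf_ip M k (\<lambda>a x. \<Sum>m\<in>UNIV. \<psi> m (entropy_projection N M v (uh t) k x) * normal M k a $ m)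
        (\<lambda>a x. 1)"
      by (simp add: surf_ip_def quad_def right_diff_distrib sum_subtractf inner_commute)
    then show ?thesis
      using scheme[of k]
      by (simp add: ent_def entropy_rate \<delta>_def entropy_residual_def surf_ip_sum_left sum.distrib
          vh_def[symmetric] Q_def[symmetric])
  qed

  note visc = viscous[OF t, unfolded viscous_term_def, folded vh_def Q_def]
  \<comment> \<open>The viscous equation is tested with \<open>vh k\<close>, that of
    \<open>\<Theta>\<close> with \<open>\<sigma>\<close>, and that of \<open>\<sigma>\<close> with
    \<open>\<Theta>\<close>. This eliminates the derivative of \<open>vh k\<close> in favour of the
    dissipation \<open>D k\<close>.\<close>
  have g_eq: "vol_ip (Q k) (g t k) (vh k) =
      (\<Sum>i\<in>UNIV. vol_ip (Q k) (\<lambda>x. - \<sigma> t i k x) (pderiv_coord i (vh k)) +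
        surf_ip M k (\<lambda>a x. (normal M k a $ i) *\<^sub>R average M (\<sigma> t i) k a x) (\<lambda>a. vh k))" for k
    using visc vh_mem by blast
  have \<Theta>_eq: "vol_ip (Q k) (\<Theta> t i k) (\<sigma> t i k) =
      vol_ip (Q k) (pderiv_coord i (vh k)) (\<sigma> t i k) +
      1/2 * surf_ip M k (\<lambda>a x. (normal M k a $ i) *\<^sub>R jump M vh k a x) (\<lambda>a. \<sigma> t i k)" for i k
    using visc by blast
  have \<sigma>_eq: "vol_ip (Q k) (\<sigma> t i k) (\<Theta> t i k) =
      (\<Sum>j\<in>UNIV. vol_ip (Q k) (\<lambda>x. \<epsilon> k (uh t) *\<^sub>R (K (uh t) k x i j *v \<Theta> t j k x)) (\<Theta> t i k))" for i k
    unfolding vol_ip_sum_left[symmetric] using visc by blast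
  \<comment> \<open>The surface terms left by this elimination, in the form that
    \<open>sum_surface_jump_average\<close> cancels for each coordinate \<open>i\<close>
    separately.\<close>
  define face where "face i k =
    1/2 * surf_ip M k (\<lambda>a x. (normal M k a $ i) *\<^sub>R jump M vh k a x) (\<lambda>a. \<sigma> t i k) +
    surf_ip M k (\<lambda>a x. (normal M k a $ i) *\<^sub>R average M (\<sigma> t i) k a x) (\<lambda>a. vh k)" for i k
  have "vol_ip (Q k) (g t k) (vh k) = (\<Sum>i\<in>UNIV. face i k - vol_ip (Q k) (\<sigma> t i k) (\<Theta> t i k))" for k
    unfolding g_eq face_def
    by (intro sum.cong refl)
      (use \<Theta>_eq in \<open>simp add: vol_ip_minus_left vol_ip_commute[of _ "\<sigma> t _ k"]\<close>)
  then have "vol_ip (Q k) (g t k) (vh k) = (\<Sum>i\<in>UNIV. face i k) - D k" for k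
    by (simp add: sum_subtractf \<sigma>_eq D_def)
  then have "(\<Sum>k\<in>UNIV. ent k) = (\<Sum>k\<in>UNIV. \<Sum>i\<in>UNIV. face i k) - (\<Sum>k\<in>UNIV. D k + \<delta> k)"
    by (simp add: balance sum_subtractf sum.distrib)
  also have "(\<Sum>k\<in>UNIV. \<Sum>i\<in>UNIV. face i k) = 0"
    unfolding face_def
    by (subst sum.swap) (intro sum.neutral ballI sum_surface_jump_average[OF mesh quadrature])
  also have "0 - (\<Sum>k\<in>UNIV. D k + \<delta> k) \<le> 0"
  proof -
    \<comment> \<open>Since \<open>- min 0 (\<delta> k)\<close> is at least
      \<open>- \<delta> k\<close> for either sign of the residual, the dissipation compensates
      it.\<close>
    have "0 \<le> D k + \<delta> k" for k
      using eps_large[of k] unfolding D_def \<delta>_def Q_def by linarith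
    then show ?thesis by (simp add: sum_nonneg)
  qed
  finally show ?thesis unfolding ent_def vh_def Q_def .
qed

end
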